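(* Let $\mathbb{K}$ be a field of characteristic not $2$ and let $n\geq 3$. Let $\mathcal{V}$ be a linear subspace of $M_n(\mathbb{K})$ such that every $M\in\mathcal{V}$ has at most two distinct eigenvalues in $\mathbb{K}$. Then $\dim\mathcal{V}\leq \binom{n}{2}+2$.
   Context: $M_n(\mathbb{K})$ denotes the algebra of $n\times n$ matrices over $\mathbb{K}$. Only eigenvalues lying in $\mathbb{K}$ itself are counted. *)

theory Defs
  imports "HOL-Analysis.Analysis"
begin

definition mat_scale :: "'a::field \<Rightarrow> 'a^'n^'m \<Rightarrow> 'a^'n^'m" where
  "mat_scale c A = (\<chi> i j. c * A $ i $ j)"

interpretation matsp: vector_space "mat_scale :: 'a::field \<Rightarrow> 'a^'n^'m \<Rightarrow> 'a^'n^'m"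
  by unfold_locales (simp_all add: mat_scale_def vec_eq_iff algebra_simps)

definition is_eigenvalue :: "'a::field^'n^'n \<Rightarrow> 'a \<Rightarrow> bool" where
  "is_eigenvalue A c \<longleftrightarrow> (\<exists>v. v \<noteq> 0 \<and> A *v v = c *s v)"

end

theory Submission
  imports Defs
begin

text \<open>If V contains a square-zero rank-one matrix with range Kx for every nonzero x, then two of
  these matrices, suitably scaled, add up to one that swaps two independent vectors, which yields
  the distinct eigenvalues 1, -1 and (as \<open>n \<ge> 3\<close>) 0. So some x is the range of no such
  matrix; then the members of V killing x act faithfully on the quotient by x, and there each of
  them has at most one nonzero eigenvalue. As the vectors Mx with M in V span at most n dimensions,
  it remains to bound spaces of matrices of size \<open>m = n - 1\<close> with at most one nonzero eigenvalue
  by \<open>(m choose 2) + 1\<close>. This goes by the same reduction and induction, except when some member A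
  of the space fixes x: then the matrices induced on the quotient are the directions of an affine
  space of nonsingular matrices, and inverting one of those reduces to spaces of matrices without
  nonzero eigenvalues, whose dimension is at most \<open>m choose 2\<close> by the same reduction again.\<close>

section \<open>Finite-dimensional preliminaries\<close>

text \<open>Rank-nullity for the restriction of f to W: preimages in W of a basis of the image,
  together with a basis of the kernel, span W.\<close>

lemma (in finite_dimensional_vector_space_pair) dim_le_dim_image_plus_dim_kernel:
  assumes f: "Vector_Spaces.linear s1 s2 f" and W: "vs1.subspace W"
  shows "vs1.dim W \<le> vs2.dim (f ` W) + vs1.dim {w \<in> W. f w = 0}"
proof -
  let ?N = "{w \<in> W. f w = 0}"
  obtain B where B: "B \<subseteq> f ` W" "vs2.independent B" "f ` W \<subseteq> vs2.span B"
      "card B = vs2.dim (f ` W)"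
    using vs2.basis_exists by blast
  obtain K where K: "K \<subseteq> ?N" "vs1.independent K" "?N \<subseteq> vs1.span K" "card K = vs1.dim ?N"
    using vs1.basis_exists by blast
  have "\<forall>b\<in>B. \<exists>w. w \<in> W \<and> f w = b"
    using B(1) by blast
  then obtain g where g: "\<And>b. b \<in> B \<Longrightarrow> g b \<in> W \<and> f (g b) = b"
    using bchoice by meson
  have fgB: "f ` g ` B = B"
    using g by force
  have gW: "vs1.span (g ` B) \<subseteq> W"
    using g by (intro vs1.span_minimal W) auto
  have finB: "finite B" and finK: "finite K"
    using B K vs1.finiteI_independent vs2.finiteI_independent by auto
  have "W \<subseteq> vs1.span (K \<union> g ` B)"
  proof
    fix w assume w: "w \<in> W"
    then have "f w \<in> f ` vs1.span (g ` B)"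
      using B(3) by (auto simp: linear_span_image[OF f, symmetric] fgB)
    then obtain u where u: "u \<in> vs1.span (g ` B)" "f w = f u"
      by auto
    then have "w - u \<in> ?N"
      using gW w W f by (auto simp: linear_diff vs1.subspace_diff)
    then have "w - u \<in> vs1.span (K \<union> g ` B)"
      using K(3) vs1.span_mono[of K "K \<union> g ` B"] by auto
    moreover have "u \<in> vs1.span (K \<union> g ` B)"
      using u vs1.span_mono[of "g ` B" "K \<union> g ` B"] by auto
    ultimately show "w \<in> vs1.span (K \<union> g ` B)"
      using vs1.span_add by fastforce
  qed
  then have "vs1.dim W \<le> card (K \<union> g ` B)"
    using finB finK by (intro vs1.dim_le_card) auto
  also have "\<dots> \<le> card K + card B"
    using card_Un_le[of K "g ` B"] card_image_le[OF finB, of g] by linarith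
  finally show ?thesis
    using B K by simp
qed

section \<open>Matrix spaces as finite-dimensional vector spaces\<close>

lemma finite_spanning_set_mat:
  "\<exists>S :: ('a::field^'n^'m) set. finite S \<and> matsp.span S = UNIV"
proof -
  let ?E = "\<lambda>(i,j). (\<chi> r s. if r = i \<and> s = j then 1 else 0) :: 'a^'n^'m"
  have "M \<in> matsp.span (range ?E)" for M :: "'a^'n^'m"
  proof -
    have "M = (\<Sum>i\<in>UNIV. \<Sum>j\<in>UNIV. mat_scale (M $ i $ j) (?E (i,j)))"
    proof (simp add: vec_eq_iff sum_component mat_scale_def, intro allI)
      fix r s
      have "(\<Sum>i\<in>UNIV. \<Sum>j\<in>UNIV. M $ i $ j * (if r = i \<and> s = j then 1 else 0))
          = (\<Sum>i\<in>UNIV. if r = i then M $ i $ s else 0)"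
        by (intro sum.cong refl) (auto simp: if_distrib cong: if_cong)
      then show "M $ r $ s
          = (\<Sum>i\<in>UNIV. \<Sum>j\<in>UNIV. M $ i $ j * (if r = i \<and> s = j then 1 else 0))"
        by simp
    qed
    also have "\<dots> \<in> matsp.span (range ?E)"
      by (intro matsp.span_sum matsp.span_scale matsp.span_base rangeI)
    finally show ?thesis .
  qed
  then show ?thesis
    by (intro exI[of _ "range ?E"]) auto
qed

text \<open>Any basis will do, so the one obtained by extending the empty set is taken; it is finite
  because the matrix units are a finite spanning set.\<close>

interpretation matsp: finite_dimensional_vector_space
  "mat_scale :: 'a::field \<Rightarrow> 'a^'n^'m \<Rightarrow> 'a^'n^'m" "matsp.extend_basis {}"
proof
  show "matsp.independent (matsp.extend_basis {} :: ('a^'n^'m) set)"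
    and "matsp.span (matsp.extend_basis {} :: ('a^'n^'m) set) = UNIV"
    by (simp_all add: matsp.independent_extend_basis matsp.span_extend_basis matsp.independent_empty)
  then show "finite (matsp.extend_basis {} :: ('a^'n^'m) set)"
    using finite_spanning_set_mat[where 'a='a and 'n='n and 'm='m] matsp.independent_span_bound
    by blast
qed

interpretation matsp_vec: finite_dimensional_vector_space_pair
  "mat_scale :: 'a::field \<Rightarrow> 'a^'n^'m \<Rightarrow> 'a^'n^'m" "matsp.extend_basis {}"
  "(*s) :: 'a \<Rightarrow> 'a^'k \<Rightarrow> 'a^'k" cart_basis
  by unfold_locales

interpretation matsp_matsp: finite_dimensional_vector_space_pair
  "mat_scale :: 'a::field \<Rightarrow> 'a^'n^'m \<Rightarrow> 'a^'n^'m" "matsp.extend_basis {}"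
  "mat_scale :: 'a::field \<Rightarrow> 'a^'k^'l \<Rightarrow> 'a^'k^'l" "matsp.extend_basis {}"
  by unfold_locales

lemma mat_scale_mult_vec [simp]: "mat_scale c A *v x = c *s (A *v x)"
  by (simp add: vec_eq_iff mat_scale_def matrix_vector_mult_def sum_distrib_left mult.assoc)

lemma mat_scale_mult_left [simp]: "mat_scale c A ** B = mat_scale c (A ** B)"
  by (simp add: vec_eq_iff mat_scale_def matrix_matrix_mult_def sum_distrib_left mult.assoc)

lemma mat_scale_mult_right [simp]: "A ** mat_scale c B = mat_scale c (A ** B)"
  by (simp add: vec_eq_iff mat_scale_def matrix_matrix_mult_def sum_distrib_left algebra_simps)

lemma linear_mat_vec: "Vector_Spaces.linear mat_scale (*s) (\<lambda>M. M *v x)"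
  by (simp add: Vector_Spaces.linear_iff matsp.vector_space_axioms vec.vector_space_axioms algebra_simps)

lemma linear_mat_mult_left: "Vector_Spaces.linear mat_scale mat_scale ((**) A)"
  by (simp add: Vector_Spaces.linear_iff matsp.vector_space_axioms matrix_add_ldistrib)

lemma matrix_eqI: "(\<And>v. A *v v = B *v v) \<Longrightarrow> A = B" for A B :: "'a::field^'n^'m"
  by (simp add: matrix_eq)

section \<open>Independence of eigenvectors and finiteness of the spectrum\<close>

lemma eigenvalue_indep:
  assumes "finite S" "\<And>c. c \<in> S \<Longrightarrow> ev c \<noteq> 0 \<and> M *v ev c = c *s ev c"
    and "(\<Sum>c\<in>S. a c *s ev c) = 0" "c \<in> S"
  shows "a c = (0::'a::field)"
  using assms
proof (induction S arbitrary: a c rule: finite_induct)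
  case (insert d S)
  \<comment> \<open>Applying M - d to the relation removes the term of d and multiplies each other
    coefficient by the nonzero factor c - d.\<close>
  have "0 = M *v (\<Sum>c\<in>insert d S. a c *s ev c) - d *s (\<Sum>c\<in>insert d S. a c *s ev c)"
    using insert.prems(2) by simp
  also have "\<dots> = (\<Sum>c\<in>insert d S. (a c * (c - d)) *s ev c)"
  proof -
    have "M *v (a c *s ev c) - d *s (a c *s ev c) = (a c * (c - d)) *s ev c"
      if "c \<in> insert d S" for c
      using insert.prems(1)[OF that] by (simp add: vec.scale algebra_simps)
    then have "(\<Sum>c\<in>insert d S. M *v (a c *s ev c) - d *s (a c *s ev c))
        = (\<Sum>c\<in>insert d S. (a c * (c - d)) *s ev c)"
      by (intro sum.cong refl)
    then show ?thesis
      by (simp only: vec.sum vec.scale_sum_right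
          sum_subtractf)
  qed
  also have "\<dots> = (\<Sum>c\<in>S. (a c * (c - d)) *s ev c)"
    using insert.hyps by simp
  finally have "a c * (c - d) = 0" if "c \<in> S" for c
    using insert.IH[of "\<lambda>c. a c * (c - d)"] insert.prems(1) that by simp
  then have S: "a c = 0" if "c \<in> S" for c
    using insert.hyps that by force
  then have "a d *s ev d = 0"
    using insert.prems(2) insert.hyps by simp
  then show ?case
    using S insert.prems by auto
qed simp

text \<open>Infinite sets have \<open>card\<close> 0, so a bound on the \<open>card\<close> of a
  spectrum says something only once the spectrum is known to be finite.\<close>

lemma finite_eigenvalues: "finite {c. is_eigenvalue M c}"
  for M :: "'a::field^'n^'n"
proof (rule ccontr)
  assume "infinite {c. is_eigenvalue M c}"
  then obtain S where S: "S \<subseteq> {c. is_eigenvalue M c}" "finite S" "card S = Suc CARD('n)"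
    using infinite_arbitrarily_large by blast
  have "\<forall>c\<in>S. \<exists>v. v \<noteq> 0 \<and> M *v v = c *s v"
    using S(1) unfolding is_eigenvalue_def by blast
  then obtain ev where ev: "\<And>c. c \<in> S \<Longrightarrow> ev c \<noteq> 0 \<and> M *v ev c = c *s ev c"
    using bchoice by meson
  have inj: "inj_on ev S"
  proof (rule inj_onI)
    fix c d assume cd: "c \<in> S" "d \<in> S" "ev c = ev d"
    then have "c *s ev c = d *s ev c"
      using ev by metis
    then show "c = d"
      using ev cd by simp
  qed
  have "vec.independent (ev ` S)"
  proof (rule vec.independent_if_scalars_zero)
    fix f v assume *: "(\<Sum>x\<in>ev ` S. f x *s x) = 0" "v \<in> ev ` S"
    then have "(\<Sum>c\<in>S. f (ev c) *s ev c) = 0"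
      by (simp add: sum.reindex[OF inj])
    then show "f v = 0"
      using eigenvalue_indep[OF S(2) ev, of "\<lambda>c. f (ev c)"] * by auto
  qed (use S in simp)
  then have "card (ev ` S) \<le> CARD('n)"
    using vec.independent_card_le_dim[of "ev ` S" UNIV] by (simp add: card_cart_basis)
  then show False
    using card_image[OF inj] S by simp
qed

section \<open>Rank-one matrices\<close>

definition dot :: "'a::field^'n \<Rightarrow> 'a^'n \<Rightarrow> 'a" where
  "dot u v = (\<Sum>i\<in>UNIV. u $ i * v $ i)"

text \<open>The product of the column x and the row u. Its square is \<open>dot u x\<close> times
  itself, so \<open>dot u x = 0\<close> makes it square-zero.\<close>

definition outer :: "'a::field^'m \<Rightarrow> 'a^'n \<Rightarrow> 'a^'n^'m" where
  "outer x u = (\<chi> i j. x $ i * u $ j)"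

lemma dot_add [simp]: "dot u (v + w) = dot u v + dot u w"
  by (simp add: dot_def sum.distrib algebra_simps)

lemma dot_diff [simp]: "dot u (v - w) = dot u v - dot u w"
  by (simp add: dot_def sum_subtractf algebra_simps)

lemma dot_scale [simp]: "dot u (c *s v) = c * dot u v"
  by (simp add: dot_def sum_distrib_left algebra_simps)

lemma dot_minus [simp]: "dot u (- v) = - dot u v"
  by (simp add: dot_def sum_negf)

lemma dot_0 [simp]: "dot u 0 = 0"
  by (simp add: dot_def)

lemma dot_vector_matrix: "dot (u v* A) v = dot u (A *v v)"
proof -
  have "dot (u v* A) v = (\<Sum>j\<in>UNIV. \<Sum>i\<in>UNIV. u $ i * A $ i $ j * v $ j)"
    by (simp add: dot_def vector_matrix_mult_def sum_distrib_right)
  also have "\<dots> = dot u (A *v v)"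
    by (subst sum.swap)
       (simp add: dot_def matrix_vector_mult_def sum_distrib_left mult.assoc)
  finally show ?thesis .
qed

lemma outer_mult_vec [simp]: "outer x u *v v = dot u v *s x"
  by (simp add: outer_def vec_eq_iff matrix_vector_mult_def dot_def sum_distrib_left
      mult.commute mult.left_commute)

lemma dot_axis_right: "dot u (axis i 1) = u $ i"
  by (simp add: dot_def axis_def if_distrib cong: if_cong)

lemma exists_dot_nonzero: "u \<noteq> 0 \<Longrightarrow> \<exists>v. dot u v \<noteq> 0"
proof -
  assume "u \<noteq> 0"
  then obtain i where "u $ i \<noteq> 0"
    by (auto simp: vec_eq_iff)
  then have "dot u (axis i 1) \<noteq> 0"
    by (simp add: dot_axis_right)
  then show ?thesis ..
qed

lemma exists_dot_eq_1:
  assumes "x \<noteq> 0"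
  shows "\<exists>u. dot u x = 1"
proof -
  obtain i where "x $ i \<noteq> 0"
    using assms by (auto simp: vec_eq_iff)
  then have "dot (axis i (1 / x $ i)) x = 1"
    by (simp add: dot_def axis_def if_distrib if_distribR cong: if_cong)
  then show ?thesis ..
qed

lemma swap_in_subspace:
  fixes W :: "('a::field^'n^'n) set"
  assumes W: "matsp.subspace W" "outer x u \<in> W" "outer y w \<in> W"
    and 0: "dot u x = 0" "dot w y = 0" and 1: "dot u y \<noteq> 0" "dot w x \<noteq> 0"
  shows "\<exists>M\<in>W. is_eigenvalue M 1 \<and> is_eigenvalue M (-1) \<and>
    (CARD('n) \<ge> 3 \<longrightarrow> is_eigenvalue M 0)"
proof -
  \<comment> \<open>The scalars are chosen so that M sends x to y and y to x.\<close>
  define M where "M = mat_scale (1 / dot u y) (outer x u) + mat_scale (1 / dot w x) (outer y w)"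
  have MW: "M \<in> W"
    unfolding M_def using W by (intro matsp.subspace_add matsp.subspace_scale)
  have M: "M *v v = (dot u v / dot u y) *s x + (dot w v / dot w x) *s y" for v
    by (simp add: M_def algebra_simps)
  have "x + y \<noteq> 0"
    using 0 1 by (metis add_eq_0_iff dot_minus neg_equal_0_iff_equal)
  moreover have "M *v (x + y) = 1 *s (x + y)"
    using 0 1 by (simp add: M)
  moreover have "x - y \<noteq> 0"
    using 0 1 by auto
  moreover have "M *v (x - y) = (-1) *s (x - y)"
    using 0 1 by (simp add: M)
  ultimately have "is_eigenvalue M 1" "is_eigenvalue M (-1)"
    unfolding is_eigenvalue_def by blast+
  \<comment> \<open>The range of M lies in the span of x and y, so M is not surjective, hence not
    injective, in dimension at least 3.\<close>
  moreover have "is_eigenvalue M 0" if n: "CARD('n) \<ge> 3"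
  proof (rule ccontr)
    assume "\<not> is_eigenvalue M 0"
    then have "inj ((*v) M)"
      by (auto simp: is_eigenvalue_def vec.inj_iff_eq_0)
    then have "surj ((*v) M)"
      by (intro vec.linear_inj_imp_surj) auto
    moreover have "range ((*v) M) \<subseteq> vec.span {x, y}"
      unfolding image_subset_iff M by (intro ballI vec.span_add vec.span_scale vec.span_base) auto
    ultimately have "vec.dim (UNIV :: ('a^'n) set) \<le> card {x, y}"
      by (intro vec.dim_le_card) auto
    also have "\<dots> \<le> 2"
      using card_insert_le_m1[of 2 "{y}" x] by simp
    finally show False
      using n vec_dim_card[where 'a='a and 'n='n] by simp
  qed
  ultimately show ?thesis
    using MW by blast
qed

section \<open>Vectors spanning the range of no square-zero rank-one matrix\<close>

text \<open>From a bad family f one could grow independent sets S forever: if e is the last vector added,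
  pick y outside the kernel of f e with f s y nonzero for every s in S; then f y vanishes on S
  and on y, and y does not lie in the span of S.\<close>

lemma no_asymmetric_functional_family:
  fixes F :: "('a::field^'n) set" and f :: "'a^'n \<Rightarrow> 'a^'n \<Rightarrow> 'a"
  assumes F: "vec.subspace F" "F \<noteq> {0}"
    and add: "\<And>x y z. f x (y + z) = f x y + f x z"
    and scale: "\<And>x c y. f x (c *s y) = c * f x y"
    and nz: "\<And>x. x \<in> F \<Longrightarrow> x \<noteq> 0 \<Longrightarrow> \<exists>z\<in>F. f x z \<noteq> 0"
    and diag: "\<And>x. x \<in> F \<Longrightarrow> x \<noteq> 0 \<Longrightarrow> f x x = 0"
    and asym: "\<And>x y. x \<in> F \<Longrightarrow> x \<noteq> 0 \<Longrightarrow> y \<in> F \<Longrightarrow> y \<noteq> 0 \<Longrightarrow> f x y \<noteq> 0 \<Longrightarrow> f y x = 0"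
  shows False
proof -
  have f_span: "f e v = 0" if "v \<in> vec.span S" "\<And>s. s \<in> S \<Longrightarrow> f e s = 0" for e v S
    using that(1)
    by (induction rule: vec.span_induct_alt) (use that(2) scale[of e 0 0] in \<open>auto simp: add scale\<close>)
  \<comment> \<open>The last clause strengthens the induction: any z outside the kernel of
    \<open>f e\<close> can be corrected within the span of S so that no \<open>f s\<close> with s in
    S kills it.\<close>
  have "\<exists>S e. finite S \<and> card S = Suc k \<and> S \<subseteq> F \<and> vec.independent S \<and> e \<in> S \<and> e \<noteq> 0 \<and>
      (\<forall>s\<in>S. f e s = 0) \<and>
      (\<forall>z\<in>F. f e z \<noteq> 0 \<longrightarrow> (\<exists>y. y - z \<in> vec.span S \<and> (\<forall>s\<in>S. f s y \<noteq> 0)))" for k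
  proof (induction k)
    case 0
    obtain x where x: "x \<in> F" "x \<noteq> 0"
      using F vec.subspace_0 by blast
    have "\<exists>y. y - z \<in> vec.span {x} \<and> (\<forall>s\<in>{x}. f s y \<noteq> 0)" if "f x z \<noteq> 0" for z
      using that vec.span_zero by (intro exI[of _ z]) auto
    then show ?case
      using x diag by (intro exI[of _ "{x}"] exI[of _ x]) auto
  next
    case (Suc k)
    then obtain S e where S: "finite S" "card S = Suc k" "S \<subseteq> F" "vec.independent S"
        and e: "e \<in> S" "e \<noteq> 0" "\<forall>s\<in>S. f e s = 0"
        and ext: "\<And>z. z \<in> F \<Longrightarrow> f e z \<noteq> 0 \<Longrightarrow> \<exists>y. y - z \<in> vec.span S \<and> (\<forall>s\<in>S. f s y \<noteq> 0)"
      by blast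
    have SF: "vec.span S \<subseteq> F"
      using S F by (intro vec.span_minimal)
    obtain z where z: "z \<in> F" "f e z \<noteq> 0"
      using nz e S by blast
    then obtain y where y: "y - z \<in> vec.span S" "\<forall>s\<in>S. f s y \<noteq> 0"
      using ext by blast
    have yF: "y \<in> F"
      using y(1) SF z(1) vec.subspace_add[OF F(1), of "y - z" z] by auto
    \<comment> \<open>\<open>f e\<close> vanishes on the span of S but not at y.\<close>
    have y_span: "y \<notin> vec.span S"
      using f_span[of y S e] e y by auto
    then have y0: "y \<noteq> 0" "y \<notin> S"
      using vec.span_zero vec.span_base by auto
    have S0: "s \<noteq> 0" if "s \<in> S" for s
      using S(4) that vec.dependent_zero by blast
    have fy: "\<forall>s\<in>insert y S. f y s = 0"
      using asym y y0 yF S0 S(3) diag by blast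
    have "\<exists>y'. y' - z' \<in> vec.span (insert y S) \<and> (\<forall>s\<in>insert y S. f s y' \<noteq> 0)"
      if z': "z' \<in> F" "f y z' \<noteq> 0" for z'
    proof -
      \<comment> \<open>If \<open>f e\<close> kills z', adding y repairs this. The shift does not
        affect \<open>f y\<close>, which vanishes on y and on S.\<close>
      obtain t where t: "f e (z' + t *s y) \<noteq> 0"
      proof (cases "f e z' = 0")
        case True
        then have "f e (z' + 1 *s y) \<noteq> 0"
          using y e by (simp add: add)
        then show ?thesis by (rule that)
      next
        case False
        then have "f e (z' + 0 *s y) \<noteq> 0"
          by simp
        then show ?thesis by (rule that)
      qed
      moreover have "z' + t *s y \<in> F"
        using z' yF F by (intro vec.subspace_add vec.subspace_scale)
      ultimately obtain y' where y': "y' - (z' + t *s y) \<in> vec.span S" "\<forall>s\<in>S. f s y' \<noteq> 0"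
        using ext by blast
      have y'z: "y' - z' \<in> vec.span (insert y S)"
        using y'(1) unfolding vec.span_insert by (auto intro!: exI[of _ t] simp: algebra_simps)
      have "f y y' = f y (y' - z') + f y z'"
        by (metis add diff_add_cancel)
      also have "f y (y' - z') = 0"
        using f_span[OF y'z] fy by blast
      finally show ?thesis
        using y'z y' z' by auto
    qed
    then show ?case
      using S y0 yF y_span fy
      by (intro exI[of _ "insert y S"] exI[of _ y]) (auto simp: vec.independent_insert)
  qed
  from this[of "CARD('n)"] obtain S :: "('a^'n) set" where "card S = Suc CARD('n)" "vec.independent S"
    by blast
  then show False
    using vec.independent_card_le_dim[of S UNIV] by (simp add: card_cart_basis)
qed

section \<open>Corner algebras\<close>

text \<open>For an idempotent P the corner is the algebra of endomorphisms of the range of P, realised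
  inside the full matrix algebra; this allows an induction on the dimension at a fixed type.\<close>

definition corner :: "'a::field^'n^'n \<Rightarrow> ('a^'n^'n) set" where
  "corner P = {M. P ** M = M \<and> M ** P = M}"

text \<open>For idempotent P this is the range of P, the space on which the corner acts; its
  dimension is the matrix size in the inductions.\<close>

definition fixed_space :: "'a::field^'n^'n \<Rightarrow> ('a^'n) set" where
  "fixed_space P = {v. P *v v = v}"

lemma subspace_fixed_space: "vec.subspace (fixed_space P)"
  by (auto simp: vec.subspace_def fixed_space_def vec.scale algebra_simps)

lemma corner_vec:
  assumes "M \<in> corner P"
  shows "P *v (M *v v) = M *v v" "M *v (P *v v) = M *v v"
  using assms by (simp_all add: corner_def matrix_vector_mul_assoc)

lemma fixed_space_0_imp_corner_0:
  assumes "P ** P = P" "fixed_space P = {0}" "M \<in> corner P"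
  shows "M = 0"
proof (rule matrix_eqI)
  fix v
  have "M *v v \<in> fixed_space P"
    using corner_vec[OF assms(3)] by (simp add: fixed_space_def)
  then show "M *v v = 0 *v v"
    using assms by simp
qed

text \<open>For nonzero x: Kx is the range of no square-zero rank-one member of W.\<close>

definition square_zero_free :: "('a::field^'n^'n) set \<Rightarrow> 'a^'n \<Rightarrow> bool" where
  "square_zero_free W x \<longleftrightarrow> (\<forall>u. outer x u \<in> W \<longrightarrow> dot u x = 0 \<longrightarrow> u = 0)"

text \<open>Otherwise each nonzero x in the fixed space carries a nonzero functional
  \<open>dot (g x)\<close> killing x, and \<open>no_swap\<close> makes this family asymmetric, which
  was shown to be impossible.\<close>

lemma exists_square_zero_free:
  assumes "W \<subseteq> corner P" "fixed_space P \<noteq> {0}" and P: "P ** P = P"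
    and no_swap: "\<And>x y u w. outer x u \<in> W \<Longrightarrow> outer y w \<in> W \<Longrightarrow> dot u x = 0 \<Longrightarrow> dot w y = 0 \<Longrightarrow>
      dot u y \<noteq> 0 \<Longrightarrow> dot w x = 0"
  shows "\<exists>x\<in>fixed_space P. x \<noteq> 0 \<and> square_zero_free W x"
proof (rule ccontr)
  assume "\<not> ?thesis"
  then have "\<exists>u. outer x u \<in> W \<and> dot u x = 0 \<and> u \<noteq> 0" if "x \<in> fixed_space P" "x \<noteq> 0" for x
    using that unfolding square_zero_free_def by blast
  then obtain g where g: "\<And>x. x \<in> fixed_space P \<Longrightarrow> x \<noteq> 0 \<Longrightarrow>
      outer x (g x) \<in> W \<and> dot (g x) x = 0 \<and> g x \<noteq> 0"
    by metis
  show False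
  proof (rule no_asymmetric_functional_family[where F = "fixed_space P" and f = "\<lambda>x. dot (g x)"])
    fix x assume x: "x \<in> fixed_space P" "x \<noteq> 0"
    obtain v where v: "dot (g x) v \<noteq> 0"
      using exists_dot_nonzero g[OF x] by blast
    have c: "outer x (g x) \<in> corner P"
      using g[OF x] assms(1) by auto
    \<comment> \<open>Membership in the corner makes the functional invariant under P, so being
      nonzero it is already nonzero on the fixed space.\<close>
    have "dot (g x) (P *v v) *s x = dot (g x) v *s x"
      using corner_vec(2)[OF c, of v] by simp
    then have "dot (g x) (P *v v) \<noteq> 0"
      using v x by auto
    moreover have "P *v v \<in> fixed_space P"
      using P by (simp add: fixed_space_def matrix_vector_mul_assoc)
    ultimately show "\<exists>z\<in>fixed_space P. dot (g x) z \<noteq> 0" ..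
    show "dot (g x) x = 0"
      using g[OF x] by blast
    show "dot (g y) x = 0" if "y \<in> fixed_space P" "y \<noteq> 0" "dot (g x) y \<noteq> 0" for y
      using no_swap g[OF x] g[OF that(1,2)] that(3) by blast
  qed (simp_all add: subspace_fixed_space assms(2))
qed


text \<open>The corner of Q models the endomorphisms of the quotient by x, with
  \<open>Q ** M\<close> as the map induced by M. A member of W that kills x and induces 0 has the
  form \<open>outer x u\<close> with \<open>dot u x = 0\<close>, so it is 0; rank-nullity for
  evaluation at x gives the inequality.\<close>

lemma corner_reduction:
  fixes P :: "'a::field^'n^'n"
  assumes P: "P ** P = P" and W: "matsp.subspace W" "W \<subseteq> corner P"
    and x: "x \<in> fixed_space P" "x \<noteq> 0" "square_zero_free W x"
  obtains Q where "Q ** Q = Q" "Q *v x = 0" "\<And>v. \<exists>s. P *v v = Q *v v + s *s x"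
    and "vec.dim (fixed_space Q) < vec.dim (fixed_space P)"
    and "matsp.subspace ((**) Q ` {M \<in> W. M *v x = 0})"
    and "(**) Q ` {M \<in> W. M *v x = 0} \<subseteq> corner Q"
    and "matsp.dim W \<le> vec.dim ((\<lambda>M. M *v x) ` W) + matsp.dim ((**) Q ` {M \<in> W. M *v x = 0})"
proof -
  obtain u where u: "dot u x = 1"
    using exists_dot_eq_1 x by blast
  let ?N = "{M \<in> W. M *v x = 0}"
  \<comment> \<open>Q is P followed by the projection along x onto the kernel of
    \<open>dot u\<close>.\<close>
  define Q where "Q = P - outer x (u v* P)"
  have Q: "Q *v v = P *v v - dot u (P *v v) *s x" for v
    by (simp add: Q_def matrix_vector_mult_diff_rdistrib dot_vector_matrix)
  have Px: "P *v x = x"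
    using x by (simp add: fixed_space_def)
  have PP: "P *v (P *v v) = P *v v" for v
    using P by (simp add: matrix_vector_mul_assoc)
  have PQ: "P *v (Q *v v) = Q *v v" for v
    by (simp add: Q PP Px vec.diff vec.scale)
  have Qx: "Q *v x = 0"
    by (simp add: Q Px u)
  have QQ: "Q *v (Q *v v) = Q *v v" for v
    by (simp add: Q[of "Q *v v"] PQ) (simp add: Q u)
  have N: "matsp.subspace ?N"
    using W(1) by (auto simp: matsp.subspace_def algebra_simps)
  have inj: "inj_on ((**) Q) ?N"
  proof -
    have "M = 0" if M: "M \<in> ?N" "Q ** M = 0" for M
    proof -
      have "M *v v = dot u (M *v v) *s x" for v
      proof -
        have "Q *v (M *v v) = 0"
          using M by (simp add: matrix_vector_mul_assoc)
        then show ?thesis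
          using corner_vec(1)[of M P v] M W(2) by (auto simp: Q)
      qed
      then have M_eq: "M = outer x (u v* M)"
        by (intro matrix_eqI) (simp add: dot_vector_matrix)
      have "outer x (u v* M) \<in> W"
        using M by (simp flip: M_eq)
      moreover have "dot (u v* M) x = 0"
        using M by (simp add: dot_vector_matrix)
      ultimately have "u v* M = 0"
        using x(3) by (simp add: square_zero_free_def)
      then show "M = 0"
        by (subst M_eq) (simp add: outer_def vec_eq_iff)
    qed
    then show ?thesis
      using matsp_matsp.linear_inj_on_iff_eq_0[OF linear_mat_mult_left N] by blast
  qed
  have dimN: "matsp.dim ((**) Q ` ?N) = matsp.dim ?N"
    by (intro matsp_matsp.dim_image_eq linear_mat_mult_left)
       (simp add: matsp.span_eq_iff[THEN iffD2, OF N] inj)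
  show ?thesis
  proof (rule that[of Q])
    show "Q ** Q = Q"
      by (intro matrix_eqI) (simp add: QQ flip: matrix_vector_mul_assoc)
    show "Q *v x = 0"
      by (fact Qx)
    show "\<exists>s. P *v v = Q *v v + s *s x" for v
      by (rule exI[of _ "dot u (P *v v)"]) (simp add: Q)
    have "v \<in> fixed_space P" if "v \<in> fixed_space Q" for v
      using PQ[of v] that by (simp add: fixed_space_def)
    moreover have "x \<notin> fixed_space Q"
      using x(2) Qx by (simp add: fixed_space_def)
    ultimately have "fixed_space Q \<subset> fixed_space P"
      using x(1) by blast
    then show "vec.dim (fixed_space Q) < vec.dim (fixed_space P)"
      by (intro vec.dim_psubset) (simp add: vec.span_eq_iff[THEN iffD2, OF subspace_fixed_space])
    show "matsp.subspace ((**) Q ` ?N)"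
      by (intro matsp_matsp.linear_subspace_image linear_mat_mult_left N)
    show "(**) Q ` ?N \<subseteq> corner Q"
    proof
      fix A assume "A \<in> (**) Q ` ?N"
      then obtain M where M: "M \<in> W" "M *v x = 0" "A = Q ** M"
        by auto
      have "M *v (Q *v v) = M *v v" for v
        using corner_vec(2)[of M P v] M W(2) by (auto simp: Q vec.diff vec.scale)
      then show "A \<in> corner Q"
        by (auto simp: corner_def M(3) QQ simp flip: matrix_vector_mul_assoc intro!: matrix_eqI)
    qed
    show "matsp.dim W \<le> vec.dim ((\<lambda>M. M *v x) ` W) + matsp.dim ((**) Q ` ?N)"
      using matsp_vec.dim_le_dim_image_plus_dim_kernel[OF linear_mat_vec[of x] W(1)] dimN by simp
  qed
qed

section \<open>Lifting eigenvalues from the quotient by x\<close>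

lemma eigenvalue_lift:
  assumes M: "M \<in> corner P" "M *v x = d *s x"
    and Q: "Q *v x = 0" "\<And>v. \<exists>s. P *v v = Q *v v + s *s x"
    and v: "Q *v (M *v v) = c *s v" "Q *v v = v" "v \<noteq> 0" and "c \<noteq> d"
  shows "is_eigenvalue M c"
proof -
  obtain s where "P *v (M *v v) = c *s v + s *s x"
    using Q(2)[of "M *v v"] unfolding v(1) by blast
  then have Mv: "M *v v = c *s v + s *s x"
    using corner_vec(1)[OF M(1)] by simp
  \<comment> \<open>t is determined by requiring v + t x to be an eigenvector for c; the equation is
    solvable because c and d differ.\<close>
  define t where "t = s / (c - d)"
  have t: "s + t * d = c * t"
    using \<open>c \<noteq> d\<close> by (simp add: t_def field_simps)
  have "M *v (v + t *s x) = c *s v + (s + t * d) *s x"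
    by (simp add: vec.add vec.scale Mv M(2) algebra_simps)
  also have "\<dots> = c *s (v + t *s x)"
    by (simp add: t vec.scale_right_distrib)
  finally have "M *v (v + t *s x) = c *s (v + t *s x)" .
  moreover have "v + t *s x \<noteq> 0"
  proof
    assume "v + t *s x = 0"
    then have "Q *v (v + t *s x) = 0"
      by simp
    then show False
      using v Q(1) by (simp add: vec.add vec.scale)
  qed
  ultimately show ?thesis
    unfolding is_eigenvalue_def by blast
qed

lemma nonzero_eigenvalue_lift:
  assumes "M \<in> corner P" "M *v x = 0" and "Q ** Q = Q"
    and "Q *v x = 0" "\<And>v. \<exists>s. P *v v = Q *v v + s *s x"
    and "is_eigenvalue (Q ** M) c" "c \<noteq> 0"
  shows "is_eigenvalue M c"
proof -
  obtain v where v: "v \<noteq> 0" "Q *v (M *v v) = c *s v"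
    using assms(6) by (auto simp: is_eigenvalue_def simp flip: matrix_vector_mul_assoc)
  \<comment> \<open>An eigenvector for a nonzero eigenvalue lies in the range of Q.\<close>
  have "c *s (Q *v v) = Q *v (Q *v (M *v v))"
    by (simp add: v vec.scale)
  also have "\<dots> = Q *v (M *v v)"
    using \<open>Q ** Q = Q\<close> by (metis matrix_vector_mul_assoc)
  finally have "Q *v v = v"
    using v \<open>c \<noteq> 0\<close> by simp
  then show ?thesis
    using eigenvalue_lift[of M P x 0 Q v c] assms v by simp
qed

section \<open>Dimension bounds\<close>

lemma image_vec_subset_fixed_space:
  "W \<subseteq> corner P \<Longrightarrow> (\<lambda>M. M *v x) ` W \<subseteq> fixed_space P"
  using corner_vec(1) unfolding fixed_space_def by blast

text \<open>The values Mx form a subspace of the fixed space that misses x itself.\<close>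

lemma dim_image_vec_less:
  assumes "matsp.subspace W" "W \<subseteq> corner P" "x \<in> fixed_space P" "\<And>M. M \<in> W \<Longrightarrow> M *v x \<noteq> x"
  shows "vec.dim ((\<lambda>M. M *v x) ` W) < vec.dim (fixed_space P)"
proof -
  have "vec.subspace ((\<lambda>M. M *v x) ` W)"
    using assms by (intro matsp_vec.linear_subspace_image linear_mat_vec)
  moreover have "(\<lambda>M. M *v x) ` W \<subset> fixed_space P"
    using image_vec_subset_fixed_space[OF assms(2), of x] assms(3,4) by force
  ultimately show ?thesis
    by (intro vec.dim_psubset) (metis vec.span_eq_iff subspace_fixed_space)
qed

lemma choose_two_Suc: "Suc m choose 2 = m + (m choose 2)"
  by (simp add: numeral_2_eq_2)

lemma dim_0_if_fixed_space_0:
  assumes "P ** P = P" "fixed_space P = {0}" "W \<subseteq> corner P"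
  shows "matsp.dim W = 0"
proof -
  have "W \<subseteq> {0}"
    using fixed_space_0_imp_corner_0[OF assms(1,2)] assms(3) by blast
  then show ?thesis
    by simp
qed

text \<open>Induction on m. A swap would have eigenvalue 1, so a suitable x exists; Mx = x is
  excluded likewise, so in size \<open>Suc m\<close> evaluation at x contributes at most m and the
  quotient at most \<open>m choose 2\<close>.\<close>

lemma dim_le_if_trivial_spectrum:
  assumes "P ** P = P" "matsp.subspace W" "W \<subseteq> corner P"
    and "\<And>M c. M \<in> W \<Longrightarrow> is_eigenvalue M c \<Longrightarrow> c = 0"
    and "vec.dim (fixed_space P) \<le> m"
  shows "matsp.dim W \<le> m choose 2"
  using assms
proof (induction m arbitrary: P W)
  case 0
  then have "fixed_space P = {0}"
    using vec.subspace_0[OF subspace_fixed_space[of P]] by auto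
  then have "matsp.dim W = 0"
    by (rule dim_0_if_fixed_space_0[OF 0(1) _ 0(3)])
  then show ?case
    by linarith
next
  case (Suc m)
  note P = Suc.prems(1) and W = Suc.prems(2,3) and spec = Suc.prems(4)
  show ?case
  proof (cases "fixed_space P = {0}")
    case True
    then have "matsp.dim W = 0"
      by (rule dim_0_if_fixed_space_0[OF P _ W(2)])
    then show ?thesis
      by linarith
  next
    case False
    have "\<exists>x\<in>fixed_space P. x \<noteq> 0 \<and> square_zero_free W x"
    proof (rule exists_square_zero_free[OF W(2) False P], rule ccontr)
      fix x y u w
      assume "outer x u \<in> W" "outer y w \<in> W" "dot u x = 0" "dot w y = 0"
        "dot u y \<noteq> 0" "dot w x \<noteq> 0"
      from swap_in_subspace[OF W(1) this] obtain M where "M \<in> W" "is_eigenvalue M 1"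
        by blast
      then show False
        using spec[of M 1] by simp
    qed
    then obtain x where x: "x \<in> fixed_space P" "x \<noteq> 0" "square_zero_free W x"
      by blast
    obtain Q where Q: "Q ** Q = Q" "Q *v x = 0" "\<And>v. \<exists>s. P *v v = Q *v v + s *s x"
      and less: "vec.dim (fixed_space Q) < vec.dim (fixed_space P)"
      and W': "matsp.subspace ((**) Q ` {M \<in> W. M *v x = 0})"
        "(**) Q ` {M \<in> W. M *v x = 0} \<subseteq> corner Q"
      and dim: "matsp.dim W
        \<le> vec.dim ((\<lambda>M. M *v x) ` W) + matsp.dim ((**) Q ` {M \<in> W. M *v x = 0})"
      by (rule corner_reduction[OF P W x]) blast
    have "M *v x \<noteq> x" if "M \<in> W" for M
      using spec[OF that, of 1] x(2) by (auto simp: is_eigenvalue_def)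
    then have "vec.dim ((\<lambda>M. M *v x) ` W) \<le> m"
      using dim_image_vec_less[OF W x(1)] Suc.prems(5) by fastforce
    moreover have "matsp.dim ((**) Q ` {M \<in> W. M *v x = 0}) \<le> m choose 2"
    proof (rule Suc.IH[OF Q(1) W'])
      show "c = 0" if A: "A \<in> (**) Q ` {M \<in> W. M *v x = 0}" "is_eigenvalue A c" for A c
      proof (rule ccontr)
        assume "c \<noteq> 0"
        obtain M where M: "M \<in> W" "M *v x = 0" "A = Q ** M"
          using A by blast
        have "is_eigenvalue M c"
          using nonzero_eigenvalue_lift[OF subsetD[OF W(2) M(1)] M(2) Q] A(2) \<open>c \<noteq> 0\<close> M(3)
          by simp
        then show False
          using spec M(1) \<open>c \<noteq> 0\<close> by blast
      qed
    qed (use less Suc.prems(5) in linarith)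
    ultimately show ?thesis
      using dim by (simp add: choose_two_Suc)
  qed
qed

text \<open>With B an inverse of A on the fixed space, the products BM have no nonzero eigenvalue:
  BMv = cv gives Mv = cAv, so A - M/c would kill v.\<close>

lemma dim_le_if_affine_nonsingular:
  fixes P :: "'a::field^'n^'n"
  assumes P: "P ** P = P" and W: "matsp.subspace W" "W \<subseteq> corner P" and A: "A \<in> corner P"
    and nonsing: "\<And>M v. M \<in> W \<Longrightarrow> v \<in> fixed_space P \<Longrightarrow> (A + M) *v v = 0 \<Longrightarrow> v = 0"
    and m: "vec.dim (fixed_space P) \<le> m"
  shows "matsp.dim W \<le> m choose 2"
proof -
  \<comment> \<open>C agrees with A on the range of P and is the identity on the kernel of P, so it
    is invertible as a full matrix.\<close>
  define C where "C = A + mat 1 - P"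
  have C: "C *v v = A *v v + v - P *v v" for v
    by (simp add: C_def algebra_simps)
  have PP: "P *v (P *v v) = P *v v" for v
    using P by (simp add: matrix_vector_mul_assoc)
  have PC: "P ** C = C ** P"
    by (intro matrix_eqI)
      (simp add: C PP corner_vec[OF A] vec.add vec.diff flip: matrix_vector_mul_assoc)
  have "v = 0" if "C *v v = 0" for v
  proof -
    have "P *v (C *v v) = 0"
      using that by simp
    then have Av: "A *v v = 0"
      by (simp add: C PP corner_vec[OF A] vec.add vec.diff)
    then have "P *v v = v"
      using that by (simp add: C)
    then show "v = 0"
      using nonsing[of 0 v] Av matsp.subspace_0[OF W(1)] by (simp add: fixed_space_def)
  qed
  then have "\<exists>B. B ** C = mat 1"
    by (simp add: matrix_left_invertible_ker)
  then obtain B where BC: "B ** C = mat 1" ..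
  then have CB: "C ** B = mat 1"
    by (simp add: matrix_left_right_inverse)
  \<comment> \<open>Commuting with P keeps the products BM inside the corner.\<close>
  have PB: "P ** B = B ** P"
  proof -
    have "P ** B = (B ** C) ** (P ** B)"
      by (simp add: BC)
    also have "\<dots> = B ** (C ** P) ** B"
      by (simp add: matrix_mul_assoc)
    also have "\<dots> = B ** P ** (C ** B)"
      by (simp add: matrix_mul_assoc flip: PC)
    finally show ?thesis
      by (simp add: CB)
  qed
  have inj: "inj ((**) B)"
    by (metis CB injI matrix_mul_assoc matrix_mul_lid)
  have "matsp.dim W = matsp.dim ((**) B ` W)"
    by (intro matsp_matsp.dim_image_eq[symmetric] linear_mat_mult_left)
       (use inj in \<open>auto simp: inj_on_def\<close>)
  also have "\<dots> \<le> m choose 2"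
  proof (rule dim_le_if_trivial_spectrum[OF P _ _ _ m])
    show "matsp.subspace ((**) B ` W)"
      by (intro matsp_matsp.linear_subspace_image linear_mat_mult_left W)
    show BW: "(**) B ` W \<subseteq> corner P"
    proof
      fix N assume "N \<in> (**) B ` W"
      then obtain M where M: "N = B ** M" "P ** M = M" "M ** P = M"
        using W(2) by (auto simp: corner_def)
      have "P ** N = B ** (P ** M)"
        by (simp add: M(1) matrix_mul_assoc PB)
      then show "N \<in> corner P"
        using M by (simp add: corner_def flip: matrix_mul_assoc)
    qed
    fix N c assume N: "N \<in> (**) B ` W" "is_eigenvalue N c"
    then obtain M v where M: "M \<in> W" "N = B ** M" and v: "v \<noteq> 0" "N *v v = c *s v"
      by (auto simp: is_eigenvalue_def)
    show "c = 0"
    proof (rule ccontr)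
      assume c: "c \<noteq> 0"
      have "P *v (N *v v) = N *v v"
        using BW N(1) corner_vec by blast
      then have Pv: "P *v v = v"
        using c by (simp add: v vec.scale)
      have "M *v v = C *v (N *v v)"
        by (simp add: M(2) matrix_vector_mul_assoc matrix_mul_assoc CB)
      also have "\<dots> = c *s (A *v v)"
        by (simp add: v vec.scale C Pv)
      finally have "(A + mat_scale (- (1 / c)) M) *v v = 0"
        using c by (simp add: algebra_simps)
      moreover have "mat_scale (- (1 / c)) M \<in> W"
        using M W by (intro matsp.subspace_scale)
      ultimately show False
        using nonsing Pv v by (auto simp: fixed_space_def)
    qed
  qed
  finally show ?thesis .
qed

text \<open>This is how the characteristic enters: it keeps the eigenvalues 1 and -1 of a swap, and
  those in the affine argument, distinct.\<close>

lemma one_neq_minus_one: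
  assumes "CHAR('a::field) \<noteq> 2"
  shows "(1::'a) \<noteq> -1"
proof
  assume "(1::'a) = -1"
  then have "of_nat 2 = (0::'a)"
    by (metis add.right_inverse of_nat_numeral one_add_one)
  then have "CHAR('a) dvd 2"
    by (simp only: of_nat_eq_0_iff_char_dvd)
  then have "CHAR('a) \<le> 2" "CHAR('a) \<noteq> 0"
    by (simp add: dvd_imp_le, metis dvd_0_left_iff zero_neq_numeral)
  then show False
    using assms CHAR_not_1[where 'a='a] by linarith
qed

text \<open>If A is a member of the space fixing x, then for every M in the space killing x the matrix
  A + M has the eigenvalue 1, so it cannot have the eigenvalue -1 on the quotient by x. Hence the
  induced matrices form, after a shift, an affine space of nonsingular matrices.\<close>

lemma dim_le_if_one_nonzero_eigenvalue:
  fixes P :: "'a::field^'n^'n"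
  assumes char: "CHAR('a) \<noteq> 2"
    and "P ** P = P" "matsp.subspace W" "W \<subseteq> corner P"
    and "\<And>M c d. M \<in> W \<Longrightarrow> is_eigenvalue M c \<Longrightarrow> is_eigenvalue M d \<Longrightarrow> c \<noteq> 0 \<Longrightarrow> d \<noteq> 0 \<Longrightarrow> c = d"
    and "vec.dim (fixed_space P) \<le> m"
  shows "matsp.dim W \<le> (m choose 2) + 1"
  using assms(2-)
proof (induction m arbitrary: P W)
  case 0
  then have "fixed_space P = {0}"
    using vec.subspace_0[OF subspace_fixed_space[of P]] by auto
  then have "matsp.dim W = 0"
    by (rule dim_0_if_fixed_space_0[OF 0(1) _ 0(3)])
  then show ?case
    by linarith
next
  case (Suc m)
  note P = Suc.prems(1) and W = Suc.prems(2,3) and spec = Suc.prems(4)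
  show ?case
  proof (cases "fixed_space P = {0}")
    case True
    then have "matsp.dim W = 0"
      by (rule dim_0_if_fixed_space_0[OF P _ W(2)])
    then show ?thesis
      by linarith
  next
    case False
    have "\<exists>x\<in>fixed_space P. x \<noteq> 0 \<and> square_zero_free W x"
    proof (rule exists_square_zero_free[OF W(2) False P], rule ccontr)
      fix x y u w
      assume "outer x u \<in> W" "outer y w \<in> W" "dot u x = 0" "dot w y = 0"
        "dot u y \<noteq> 0" "dot w x \<noteq> 0"
      from swap_in_subspace[OF W(1) this]
      obtain M where "M \<in> W" "is_eigenvalue M 1" "is_eigenvalue M (-1)"
        by blast
      then show False
        using spec[of M 1 "-1"] one_neq_minus_one[OF char] by simp
    qed
    then obtain x where x: "x \<in> fixed_space P" "x \<noteq> 0" "square_zero_free W x"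
      by blast
    obtain Q where Q: "Q ** Q = Q" "Q *v x = 0" "\<And>v. \<exists>s. P *v v = Q *v v + s *s x"
      and less: "vec.dim (fixed_space Q) < vec.dim (fixed_space P)"
      and W': "matsp.subspace ((**) Q ` {M \<in> W. M *v x = 0})"
        "(**) Q ` {M \<in> W. M *v x = 0} \<subseteq> corner Q"
      and dim: "matsp.dim W
        \<le> vec.dim ((\<lambda>M. M *v x) ` W) + matsp.dim ((**) Q ` {M \<in> W. M *v x = 0})"
      by (rule corner_reduction[OF P W x]) blast
    have less': "vec.dim (fixed_space Q) \<le> m"
      using less Suc.prems(5) by linarith
    show ?thesis
    \<comment> \<open>If no member fixes x, evaluation at x contributes at most m and the induction
      hypothesis suffices. Otherwise it may contribute \<open>Suc m\<close>, and the quotient must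
      satisfy the bound without the extra 1.\<close>
    proof (cases "\<exists>A\<in>W. A *v x = x")
      case False
      then have "vec.dim ((\<lambda>M. M *v x) ` W) \<le> m"
        using dim_image_vec_less[OF W x(1)] Suc.prems(5) by fastforce
      moreover have "matsp.dim ((**) Q ` {M \<in> W. M *v x = 0}) \<le> (m choose 2) + 1"
      proof (rule Suc.IH[OF Q(1) W' _ less'])
        fix A c d
        assume *: "A \<in> (**) Q ` {M \<in> W. M *v x = 0}" "is_eigenvalue A c" "is_eigenvalue A d"
          "c \<noteq> 0" "d \<noteq> 0"
        then obtain M where M: "M \<in> W" "M *v x = 0" "A = Q ** M"
          by blast
        have "is_eigenvalue M c" "is_eigenvalue M d"
          using nonzero_eigenvalue_lift[OF subsetD[OF W(2) M(1)] M(2) Q] * M(3) by simp_all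
        then show "c = d"
          using spec M * by blast
      qed
      ultimately show ?thesis
        using dim by (simp add: choose_two_Suc)
    next
      case True
      then obtain A where A: "A \<in> W" "A *v x = x"
        by blast
      have "vec.dim ((\<lambda>M. M *v x) ` W) \<le> Suc m"
        using vec.dim_subset[OF image_vec_subset_fixed_space[OF W(2), of x]] Suc.prems(5)
        by linarith
      moreover have "matsp.dim ((**) Q ` {M \<in> W. M *v x = 0}) \<le> m choose 2"
      proof (rule dim_le_if_affine_nonsingular[OF Q(1) W' _ _ less'])
        \<comment> \<open>This represents the map induced by A plus the identity. A vector killed by
          its sum with N is an eigenvector for -1 of the map induced by A + M.\<close>
        show "Q ** A ** Q + Q \<in> corner Q"
        proof -
          have "Q *v (Q *v v) = Q *v v" for v
            by (simp add: matrix_vector_mul_assoc Q(1))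
          then show ?thesis
            by (auto simp: corner_def vec.add matrix_vector_mult_add_rdistrib
                simp flip: matrix_vector_mul_assoc intro!: matrix_eqI)
        qed
        fix N v
        assume "N \<in> (**) Q ` {M \<in> W. M *v x = 0}" and v: "v \<in> fixed_space Q"
          and eq: "(Q ** A ** Q + Q + N) *v v = 0"
        then obtain M where M: "M \<in> W" "M *v x = 0" "N = Q ** M"
          by blast
        have Qv: "Q *v v = v"
          using v by (simp add: fixed_space_def)
        have AM: "A + M \<in> W" "(A + M) *v x = 1 *s x"
          using A M W(1) by (auto simp: matsp.subspace_add algebra_simps)
        have "Q *v ((A + M) *v v) = (-1) *s v"
        proof -
          have "Q *v (A *v v) + v + Q *v (M *v v) = 0"
            using eq by (simp add: M(3) Qv matrix_vector_mult_add_rdistrib flip: matrix_vector_mul_assoc)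
          then show ?thesis
            by (simp add: vec.add algebra_simps eq_neg_iff_add_eq_0)
        qed
        then have "is_eigenvalue (A + M) (-1)" if "v \<noteq> 0"
          using eigenvalue_lift[OF subsetD[OF W(2) AM(1)] AM(2) Q(2,3) _ Qv that]
            one_neq_minus_one[OF char] by simp
        moreover have "is_eigenvalue (A + M) 1"
          using AM(2) x(2) unfolding is_eigenvalue_def by blast
        ultimately show "v = 0"
          using spec[OF AM(1), of "-1" 1] one_neq_minus_one[OF char] by fastforce
      qed
      ultimately show ?thesis
        using dim by (simp add: choose_two_Suc)
    qed
  qed
qed

section \<open>The bound for at most two eigenvalues\<close>

theorem mainTheorem1:
  fixes V :: "('a::field ^'n ^'n) set"
  assumes "CHAR('a) \<noteq> 2"
    and "CARD('n) \<ge> 3"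
    and "matsp.subspace V"
    and "\<forall>M\<in>V. card {c. is_eigenvalue M c} \<le> 2"
  shows "matsp.dim V \<le> (CARD('n) choose 2) + 2"
proof -
  have spec: False if "M \<in> V" "is_eigenvalue M 0" "is_eigenvalue M c" "is_eigenvalue M d"
    "c \<noteq> 0" "d \<noteq> 0" "c \<noteq> d" for M c d
  proof -
    have "card {0, c, d} \<le> card {c. is_eigenvalue M c}"
      using that by (intro card_mono finite_eigenvalues) auto
    moreover have "card {0, c, d} = 3"
      using that by auto
    ultimately show False
      using assms(4) that(1) by force
  qed
  \<comment> \<open>The full matrix algebra is the corner of the identity, so the reduction applies
    to V itself.\<close>
  have fs: "fixed_space (mat 1) = (UNIV :: ('a^'n) set)"
    by (simp add: fixed_space_def)
  have VI: "V \<subseteq> corner (mat 1)"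
    by (auto simp: corner_def)
  have fs0: "fixed_space (mat 1 :: 'a^'n^'n) \<noteq> {0}"
    unfolding fs by (metis UNIV_I axis_eq_0_iff singletonD zero_neq_one)
  have PI: "mat 1 ** mat 1 = (mat 1 :: 'a^'n^'n)"
    by simp
  have "\<exists>x\<in>fixed_space (mat 1). x \<noteq> 0 \<and> square_zero_free V x"
  proof (rule exists_square_zero_free[OF VI fs0 PI], rule ccontr)
    fix x y u w
    assume "outer x u \<in> V" "outer y w \<in> V" "dot u x = 0" "dot w y = 0"
      "dot u y \<noteq> 0" "dot w x \<noteq> 0"
    from swap_in_subspace[OF assms(3) this]
    obtain M where "M \<in> V" "is_eigenvalue M 1" "is_eigenvalue M (-1)" "is_eigenvalue M 0"
      using assms(2) by blast
    then show False
      using spec[of M 1 "-1"] one_neq_minus_one[OF assms(1)] by simp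
  qed
  then obtain x where x: "x \<in> fixed_space (mat 1)" "x \<noteq> 0" "square_zero_free V x"
    by blast
  obtain Q where Q: "Q ** Q = Q" "Q *v x = 0" "\<And>v. \<exists>s. mat 1 *v v = Q *v v + s *s x"
    and less: "vec.dim (fixed_space Q) < vec.dim (fixed_space (mat 1 :: 'a^'n^'n))"
    and W': "matsp.subspace ((**) Q ` {M \<in> V. M *v x = 0})"
      "(**) Q ` {M \<in> V. M *v x = 0} \<subseteq> corner Q"
    and dim: "matsp.dim V
      \<le> vec.dim ((\<lambda>M. M *v x) ` V) + matsp.dim ((**) Q ` {M \<in> V. M *v x = 0})"
    by (rule corner_reduction[OF PI assms(3) VI x]) blast
  obtain m where m: "CARD('n) = Suc m"
    using assms(2) by (cases "CARD('n)") auto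
  have "vec.dim ((\<lambda>M. M *v x) ` V) \<le> CARD('n)"
    using vec.dim_subset[OF subset_UNIV] vec_dim_card by metis
  moreover have "matsp.dim ((**) Q ` {M \<in> V. M *v x = 0}) \<le> (m choose 2) + 1"
  proof (rule dim_le_if_one_nonzero_eigenvalue[OF assms(1) Q(1) W'])
    show "vec.dim (fixed_space Q) \<le> m"
      using less m vec_dim_card[where 'a='a and 'n='n] by (simp add: fs)
    fix A c d
    assume *: "A \<in> (**) Q ` {M \<in> V. M *v x = 0}" "is_eigenvalue A c" "is_eigenvalue A d"
      "c \<noteq> 0" "d \<noteq> 0"
    then obtain M where M: "M \<in> V" "M *v x = 0" "A = Q ** M"
      by blast
    have "is_eigenvalue M c" "is_eigenvalue M d"
      using nonzero_eigenvalue_lift[OF subsetD[OF VI M(1)] M(2) Q] * M(3) by simp_all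
    \<comment> \<open>M kills x, so 0 is one of its at most two eigenvalues and only one nonzero
      eigenvalue remains.\<close>
    moreover have "is_eigenvalue M 0"
      using M x by (auto simp: is_eigenvalue_def)
    ultimately show "c = d"
      using spec M * by blast
  qed
  \<comment> \<open>Evaluation contributes \<open>Suc m\<close> and the quotient
    \<open>(m choose 2) + 1\<close>; since \<open>Suc m choose 2\<close> is
    \<open>m + (m choose 2)\<close>, an excess of 2 is left.\<close>
  ultimately show ?thesis
    using dim by (simp add: m choose_two_Suc)
qed

end
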